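(* For every integer $v\geq 2$, $t(L_2(v)) = v-1$. Moreover, if $S$ is a disconnecting set of vertices of $L_2(v)$ such that $\frac{|S|}{c(L_2(v)\setminus S)}=v-1$, then $S$ is the complement of a maximum independent set (of size $v$) of $L_2(v)$, or $S$ is the neighborhood of some vertex of $L_2(v)$.
   Context: All graphs are finite, simple and undirected. The Lattice graph $L_2(v)$ is the line graph of the complete bipartite graph $K_{v,v}$; equivalently, its vertices are the cells of a $v\times v$ grid, two distinct cells being adjacent if and only if they are in the same row or the same column. For a connected graph $G$ and a vertex subset $S$, $c(G\setminus S)$ denotes the number of connected components of the graph obtained from $G$ by removing the vertices of $S$; $S$ is called disconnecting if $c(G\setminus S)\ge 2$. The toughness of $G$ is $t(G)=\min_S \frac{|S|}{c(G\setminus S)}$, the minimum being over all disconnecting vertex sets $S$. The neighborhood of a vertex is the set of vertices adjacent to it. *)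

theory Defs
  imports Complex_Main "Graph_Theory.Graph_Theory"
begin

text \<open>
  As in the Graph Theory entry, an undirected simple graph is a digraph satisfying the locale
  \<open>graph\<close>: finite, loop-free, without parallel arcs, and with a symmetric arc relation.
\<close>

definition neighborhood :: "('a, 'b) pre_digraph \<Rightarrow> 'a \<Rightarrow> 'a set" where
  "neighborhood G x = {y. x \<rightarrow>\<^bsub>G\<^esub> y}"

definition independent_set :: "('a, 'b) pre_digraph \<Rightarrow> 'a set \<Rightarrow> bool" where
  "independent_set G I \<longleftrightarrow> I \<subseteq> verts G \<and> (\<forall>x\<in>I. \<forall>y\<in>I. \<not> x \<rightarrow>\<^bsub>G\<^esub> y)"

definition maximum_independent_set :: "('a, 'b) pre_digraph \<Rightarrow> 'a set \<Rightarrow> bool" where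
  "maximum_independent_set G I \<longleftrightarrow>
     independent_set G I \<and> (\<forall>J. independent_set G J \<longrightarrow> card J \<le> card I)"

text \<open>
  The number \<open>c(G \<setminus> S)\<close>. Since arcs are symmetric, the strongly connected components of
  the induced subgraph on the remaining vertices are its connected components.
\<close>

definition components_without :: "('a, 'b) pre_digraph \<Rightarrow> 'a set \<Rightarrow> nat" where
  "components_without G S = card (pre_digraph.sccs_verts (G \<restriction> (verts G - S)))"

definition disconnecting :: "('a, 'b) pre_digraph \<Rightarrow> 'a set \<Rightarrow> bool" where
  "disconnecting G S \<longleftrightarrow> S \<subseteq> verts G \<and> components_without G S \<ge> 2"

text \<open>
  Only meaningful for connected graphs having a disconnecting set (that is, noncomplete ones);
  otherwise the minimum is over the empty set and the value is unspecified.
\<close>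

definition toughness :: "('a, 'b) pre_digraph \<Rightarrow> real" where
  "toughness G =
     Min ((\<lambda>S. real (card S) / real (components_without G S)) ` {S. disconnecting G S})"

definition lattice_graph :: "nat \<Rightarrow> (nat \<times> nat, (nat \<times> nat) \<times> (nat \<times> nat)) pre_digraph"
  (\<open>L\<^sub>2\<close>) where
  "L\<^sub>2 v = with_proj
     \<lparr> pverts = {..<v} \<times> {..<v},
       parcs = {(p, q). p \<in> {..<v} \<times> {..<v} \<and> q \<in> {..<v} \<times> {..<v} \<and>
                  p \<noteq> q \<and> (fst p = fst q \<or> snd p = snd q)} \<rparr>"

lemma graph_lattice_graph: "graph (L\<^sub>2 v)"
proof -
  have "finite {(p, q). p \<in> {..<v} \<times> {..<v} \<and> q \<in> {..<v} \<times> {..<v} \<and>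
                  p \<noteq> q \<and> (fst p = fst q \<or> snd p = snd q)}"
    by (rule finite_subset[of _ "({..<v} \<times> {..<v}) \<times> ({..<v} \<times> {..<v})"]) auto
  then have "pair_graph \<lparr> pverts = {..<v} \<times> {..<v},
       parcs = {(p, q). p \<in> {..<v} \<times> {..<v} \<and> q \<in> {..<v} \<times> {..<v} \<and>
                  p \<noteq> q \<and> (fst p = fst q \<or> snd p = snd q)} \<rparr>"
    by unfold_locales (auto simp: symmetric_def intro!: symI)
  then interpret pair_graph "\<lparr> pverts = {..<v} \<times> {..<v},
       parcs = {(p, q). p \<in> {..<v} \<times> {..<v} \<and> q \<in> {..<v} \<times> {..<v} \<and>
                  p \<noteq> q \<and> (fst p = fst q \<or> snd p = snd q)} \<rparr>" .
  show ?thesis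
    unfolding lattice_graph_def by unfold_locales
qed

lemma connected_lattice_graph:
  assumes "v \<ge> 1"
  shows "connected (L\<^sub>2 v)"
proof -
  interpret graph "L\<^sub>2 v" by (rule graph_lattice_graph)
  have reach: "x \<rightarrow>\<^sup>*\<^bsub>L\<^sub>2 v\<^esub> y" if "x \<in> verts (L\<^sub>2 v)" "y \<in> verts (L\<^sub>2 v)" for x y
  proof -
    have step: "a \<rightarrow>\<^sup>*\<^bsub>L\<^sub>2 v\<^esub> b"
      if "a \<in> verts (L\<^sub>2 v)" "b \<in> verts (L\<^sub>2 v)" "fst a = fst b \<or> snd a = snd b" for a b
    proof (cases "a = b")
      case False
      then have "a \<rightarrow>\<^bsub>L\<^sub>2 v\<^esub> b"
        using that by (simp add: lattice_graph_def)
      then show ?thesis by blast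
    qed (use that in auto)
    have "(fst x, snd y) \<in> verts (L\<^sub>2 v)"
      using that by (auto simp: lattice_graph_def)
    then have "x \<rightarrow>\<^sup>*\<^bsub>L\<^sub>2 v\<^esub> (fst x, snd y)" "(fst x, snd y) \<rightarrow>\<^sup>*\<^bsub>L\<^sub>2 v\<^esub> y"
      using that by (auto intro!: step)
    then show ?thesis by (rule reachable_trans)
  qed
  have "verts (L\<^sub>2 v) \<noteq> {}"
    using assms by (auto simp: lattice_graph_def lessThan_empty_iff)
  then have "strongly_connected (L\<^sub>2 v)"
    using reach by blast
  then show ?thesis
    unfolding connected_def strongly_connected_def reachable_mk_symmetric_eq[OF sym_arcs]
    by (simp add: mk_symmetric_def)
qed

text \<open>
  The grid description agrees with the line graph of \<open>K\<^bsub>v,v\<^esub>\<close>: the cell \<open>(i, j)\<close> is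
  the edge joining vertex \<open>i\<close> of the left part to vertex \<open>j\<close> of the right part, and adjacency is
  being distinct edges with a common endpoint.
\<close>

lemma lattice_graph_is_line_graph:
  defines "e \<equiv> \<lambda>(i, j). {Inl i, Inr j} :: (nat + nat) set"
  shows "bij_betw e (verts (L\<^sub>2 v)) {{Inl i, Inr j} | i j. i < v \<and> j < v}"
    and "\<lbrakk>p \<in> verts (L\<^sub>2 v); q \<in> verts (L\<^sub>2 v)\<rbrakk> \<Longrightarrow>
           p \<rightarrow>\<^bsub>L\<^sub>2 v\<^esub> q \<longleftrightarrow> e p \<noteq> e q \<and> e p \<inter> e q \<noteq> {}"
proof -
  have "e p = e q \<longleftrightarrow> p = q" for p q
    by (cases p; cases q) (auto simp: e_def doubleton_eq_iff)
  then have inj: "inj e" by (simp add: inj_def)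
  have "e ` ({..<v} \<times> {..<v}) = {{Inl i, Inr j} | i j. i < v \<and> j < v}"
    by (fastforce simp: e_def)
  then show "bij_betw e (verts (L\<^sub>2 v)) {{Inl i, Inr j} | i j. i < v \<and> j < v}"
    using inj by (auto simp: lattice_graph_def bij_betw_def intro: inj_on_subset)
  assume "p \<in> verts (L\<^sub>2 v)" "q \<in> verts (L\<^sub>2 v)"
  moreover have "e p \<inter> e q \<noteq> {} \<longleftrightarrow> fst p = fst q \<or> snd p = snd q"
    by (cases p; cases q) (auto simp: e_def)
  ultimately show "p \<rightarrow>\<^bsub>L\<^sub>2 v\<^esub> q \<longleftrightarrow> e p \<noteq> e q \<and> e p \<inter> e q \<noteq> {}"
    using inj by (simp add: lattice_graph_def inj_eq)
qed

end

theory Submission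
  imports Defs
begin

text \<open>
  Distinct components of \<open>L\<^sub>2 v \<setminus> S\<close> share no row and no column. If the \<open>c\<close> components span
  \<open>r\<^sub>i\<close> rows and \<open>k\<^sub>i\<close> columns, the number of remaining cells is at most
  \<open>\<Sum> r\<^sub>i k\<^sub>i = \<Sum> (r\<^sub>i - 1)(k\<^sub>i - 1) + \<Sum> r\<^sub>i + \<Sum> k\<^sub>i - c \<le> (v - c)\<^sup>2 + 2 v - c\<close>, which equals
  \<open>v\<^sup>2 - c (v - 1) - (v - c)(c - 2)\<close>. Equality forces \<open>c = v\<close> with single cells as components, or
  \<open>c = 2\<close> with all products \<open>(r\<^sub>i - 1)(k\<^sub>j - 1)\<close>, \<open>i \<noteq> j\<close>, vanishing, so that one component is a
  single cell and the other one is everything outside its row and column.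
\<close>

section \<open>Inequalities for sums of products of integers\<close>

text \<open>Expanding the product of the sums gives the diagonal terms plus the terms
  \<open>a x * b y\<close> with \<open>x \<noteq> y\<close>. The latter are nonnegative, and in the
  equality case they add up to 0, so each of them vanishes.\<close>

lemma sum_mult_le_mult_sum:
  fixes a b :: "'a \<Rightarrow> int"
  assumes "finite P" and "\<And>x. x \<in> P \<Longrightarrow> 0 \<le> a x" and "\<And>x. x \<in> P \<Longrightarrow> 0 \<le> b x"
  shows "(\<Sum>x\<in>P. a x * b x) \<le> sum a P * sum b P"
    and "\<lbrakk>(\<Sum>x\<in>P. a x * b x) = sum a P * sum b P; x \<in> P; y \<in> P; x \<noteq> y\<rbrakk> \<Longrightarrow> a x * b y = 0"
proof -
  have "sum a P * sum b P = (\<Sum>x\<in>P. a x * (b x + sum b (P - {x})))"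
    using assms(1) by (auto simp: sum_distrib_right sum.remove[of P _ b] intro!: sum.cong)
  then have split: "sum a P * sum b P =
      (\<Sum>x\<in>P. a x * b x) + (\<Sum>x\<in>P. \<Sum>y\<in>P - {x}. a x * b y)"
    by (simp add: distrib_left sum.distrib sum_distrib_left)
  have nonneg: "0 \<le> (\<Sum>y\<in>P - {x}. a x * b y)" if "x \<in> P" for x
    using that assms by (intro sum_nonneg) auto
  then show "(\<Sum>x\<in>P. a x * b x) \<le> sum a P * sum b P"
    unfolding split by (simp add: sum_nonneg)
  assume "(\<Sum>x\<in>P. a x * b x) = sum a P * sum b P" and xy: "x \<in> P" "y \<in> P" "x \<noteq> y"
  then have "(\<Sum>x\<in>P. \<Sum>y\<in>P - {x}. a x * b y) = 0"
    using split by simp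
  then have "(\<Sum>y\<in>P - {x}. a x * b y) = 0"
    using assms(1) nonneg xy by (simp add: sum_nonneg_eq_0_iff)
  moreover have "\<forall>y\<in>P - {x}. 0 \<le> a x * b y"
    using assms xy by auto
  ultimately show "a x * b y = 0"
    using sum_nonneg_eq_0_iff[of "P - {x}" "\<lambda>y. a x * b y"] assms(1) xy by blast
qed

text \<open>With \<open>r x - 1\<close> and \<open>k x - 1\<close> as nonnegative excesses, the
  bound is a chain of separate estimates. Equality makes each of them tight, and the vanishing of
  \<open>m * (c - 2)\<close> yields the two possible values of \<open>card P\<close>.\<close>

lemma sum_mult_bound:
  fixes r k :: "'a \<Rightarrow> int"
  assumes "finite P" and r: "\<forall>x\<in>P. 1 \<le> r x" and k: "\<forall>x\<in>P. 1 \<le> k x"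
    and R: "sum r P \<le> n" and K: "sum k P \<le> n" and c: "2 \<le> card P"
  shows "(\<Sum>x\<in>P. r x * k x) \<le> n\<^sup>2 - int (card P) * (n - 1)"
    and "(\<Sum>x\<in>P. r x * k x) = n\<^sup>2 - int (card P) * (n - 1) \<Longrightarrow>
      sum r P = n \<and> sum k P = n \<and> (int (card P) = n \<or> card P = 2) \<and>
      (\<forall>x\<in>P. \<forall>y\<in>P. x \<noteq> y \<longrightarrow> (r x - 1) * (k y - 1) = 0)"
proof -
  define c where "c = int (card P)"
  define m where "m = n - c"
  define a b where "a = (\<Sum>x\<in>P. r x - 1)" and "b = (\<Sum>x\<in>P. k x - 1)"
  let ?d = "\<Sum>x\<in>P. (r x - 1) * (k x - 1)"
  have ab: "a = sum r P - c" "b = sum k P - c"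
    by (simp_all add: a_def b_def c_def sum_subtractf)
  have a: "0 \<le> a" and b: "0 \<le> b"
    using r k by (auto simp: a_def b_def intro!: sum_nonneg)
  have am: "a \<le> m" and bm: "b \<le> m"
    using R K by (simp_all add: ab m_def)
  have c2: "2 \<le> c" using c by (simp add: c_def)
  have d: "?d \<le> a * b"
    unfolding a_def b_def using assms(1) r k by (intro sum_mult_le_mult_sum) auto
  have sum: "(\<Sum>x\<in>P. r x * k x) = ?d + a + b + c"
    by (simp add: ab c_def algebra_simps sum.distrib sum_subtractf)
  have m2: "a * b \<le> m * m"
    using a b am bm by (intro mult_mono) auto
  \<comment> \<open>The terms are matched with those of \<open>sum\<close>: \<open>m * m\<close>
    dominates \<open>?d\<close>, \<open>2 * m\<close> dominates \<open>a + b\<close>, and what is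
    left over is \<open>m * (c - 2)\<close>.\<close>
  have slack: "n\<^sup>2 - c * (n - 1) = m * m + 2 * m + c + m * (c - 2)"
    by (simp add: m_def algebra_simps power2_eq_square)
  \<comment> \<open>Here \<open>m\<close> is nonnegative because \<open>0 \<le> a \<le> m\<close>;
    the other factor is where at least two blocks are needed.\<close>
  have mc: "0 \<le> m * (c - 2)"
    using a am c2 by simp
  show "(\<Sum>x\<in>P. r x * k x) \<le> n\<^sup>2 - int (card P) * (n - 1)"
    unfolding c_def[symmetric] slack sum using am bm d m2 mc by linarith
  assume "(\<Sum>x\<in>P. r x * k x) = n\<^sup>2 - int (card P) * (n - 1)"
  then have "?d + a + b + c = m * m + 2 * m + c + m * (c - 2)"
    unfolding c_def[symmetric] slack sum .
  then have "a = m" "b = m" "?d = a * b" "m * (c - 2) = 0"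
    using am bm d m2 mc by linarith+
  moreover have "(r x - 1) * (k y - 1) = 0" if "x \<in> P" "y \<in> P" "x \<noteq> y" for x y
  proof (rule sum_mult_le_mult_sum(2)[OF assms(1) _ _ _ that])
    show "?d = (\<Sum>x\<in>P. r x - 1) * (\<Sum>x\<in>P. k x - 1)"
      using \<open>?d = a * b\<close> by (simp add: a_def b_def)
  qed (use r k in force)+
  ultimately show "sum r P = n \<and> sum k P = n \<and> (int (card P) = n \<or> card P = 2) \<and>
      (\<forall>x\<in>P. \<forall>y\<in>P. x \<noteq> y \<longrightarrow> (r x - 1) * (k y - 1) = 0)"
    by (auto simp: ab m_def c_def)
qed

section \<open>Counting blocks of cells in the grid\<close>

lemma card_le_card_fst_mult_card_snd:
  assumes "finite A"
  shows "card A \<le> card (fst ` A) * card (snd ` A)"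
proof -
  have "card A \<le> card (fst ` A \<times> snd ` A)"
    using assms by (intro card_mono) (auto intro: rev_image_eqI)
  then show ?thesis by (simp add: card_cartesian_product)
qed

lemma card_1_if_card_fst_snd:
  assumes "finite A" "A \<noteq> {}" "card (fst ` A) = 1" "card (snd ` A) = 1"
  shows "card A = 1"
proof -
  have "card A \<noteq> 0" using assms by simp
  moreover have "card A \<le> 1"
    using card_le_card_fst_mult_card_snd[OF assms(1)] assms by simp
  ultimately show ?thesis by linarith
qed

text \<open>Used with \<open>f\<close> as \<open>fst\<close> and as \<open>snd\<close>: blocks that
  share no line of the grid occupy at most \<open>v\<close> lines altogether.\<close>

lemma sum_card_image_le:
  fixes f :: "'a \<Rightarrow> nat"
  assumes "finite P" and "\<And>A. A \<in> P \<Longrightarrow> f ` A \<subseteq> {..<v}"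
    and "\<And>A B. \<lbrakk>A \<in> P; B \<in> P; A \<noteq> B\<rbrakk> \<Longrightarrow> f ` A \<inter> f ` B = {}"
  shows "(\<Sum>A\<in>P. card (f ` A)) \<le> v"
proof -
  have "(\<Sum>A\<in>P. card (f ` A)) = card (\<Union>A\<in>P. f ` A)"
    using assms by (intro card_UN_disjoint[symmetric]) (auto intro: finite_subset)
  also have "\<dots> \<le> card {..<v}"
    using assms(2) by (intro card_mono) auto
  finally show ?thesis by simp
qed

text \<open>Isolates what the counting needs to know about the components left after removing a
  disconnecting set, so that it proceeds without any graph.\<close>

locale grid_blocks =
  fixes P :: "(nat \<times> nat) set set" and v :: nat
  assumes finite_P: "finite P"
    and nonempty: "\<And>A. A \<in> P \<Longrightarrow> A \<noteq> {}"
    and in_grid: "\<And>A. A \<in> P \<Longrightarrow> A \<subseteq> {..<v} \<times> {..<v}"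
    and rows: "\<And>A B. \<lbrakk>A \<in> P; B \<in> P; A \<noteq> B\<rbrakk> \<Longrightarrow> fst ` A \<inter> fst ` B = {}"
    and cols: "\<And>A B. \<lbrakk>A \<in> P; B \<in> P; A \<noteq> B\<rbrakk> \<Longrightarrow> snd ` A \<inter> snd ` B = {}"
    and two_le: "2 \<le> card P"
begin

lemma finite_block: "A \<in> P \<Longrightarrow> finite A"
  using in_grid by (meson finite_SigmaI finite_lessThan finite_subset)

lemma card_Union_blocks: "card (\<Union>P) = (\<Sum>A\<in>P. card A)"
  using rows finite_block by (intro card_Union_disjoint) (auto simp: pairwise_def disjnt_def)

lemma one_le_card_image: "\<forall>A\<in>P. 1 \<le> int (card (f ` A))"
  using finite_block nonempty by (simp add: Suc_le_eq card_gt_0_iff)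

lemma sum_card_rows: "(\<Sum>A\<in>P. int (card (fst ` A))) \<le> int v"
proof -
  have "(\<Sum>A\<in>P. card (fst ` A)) \<le> v"
    by (intro sum_card_image_le finite_P rows) (use in_grid in fastforce)
  then show ?thesis by (simp flip: of_nat_sum)
qed

lemma sum_card_cols: "(\<Sum>A\<in>P. int (card (snd ` A))) \<le> int v"
proof -
  have "(\<Sum>A\<in>P. card (snd ` A)) \<le> v"
    by (intro sum_card_image_le finite_P cols) (use in_grid in fastforce)
  then show ?thesis by (simp flip: of_nat_sum)
qed

lemmas block_bound = sum_mult_bound[of P "\<lambda>A. int (card (fst ` A))" "\<lambda>A. int (card (snd ` A))",
    OF finite_P one_le_card_image one_le_card_image sum_card_rows sum_card_cols two_le]

lemma card_block_le: "A \<in> P \<Longrightarrow> int (card A) \<le> int (card (fst ` A)) * int (card (snd ` A))"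
  using card_le_card_fst_mult_card_snd[OF finite_block] by (metis of_nat_le_iff of_nat_mult)

lemma card_Union_blocks_le_sum:
  "int (card (\<Union>P)) \<le> (\<Sum>A\<in>P. int (card (fst ` A)) * int (card (snd ` A)))"
  by (simp add: card_Union_blocks sum_mono card_block_le)

lemma card_Union_blocks_le: "int (card (\<Union>P)) \<le> (int v)\<^sup>2 - int (card P) * (int v - 1)"
  using card_Union_blocks_le_sum block_bound(1) by linarith

text \<open>Equality is inherited by both estimates behind the bound: every block fills the
  rectangle spanned by its rows and columns, and the equality case of \<open>sum_mult_bound\<close>
  holds for the row and column counts.\<close>

lemma card_Union_blocks_eq:
  assumes eq: "int (card (\<Union>P)) = (int v)\<^sup>2 - int (card P) * (int v - 1)"
  shows "(card P = v \<and> (\<forall>A\<in>P. card A = 1)) \<or>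
    (\<exists>x\<in>\<Union>P. \<Union>P = insert x {y \<in> {..<v} \<times> {..<v}. fst y \<noteq> fst x \<and> snd y \<noteq> snd x})"
proof -
  let ?r = "\<lambda>A :: (nat \<times> nat) set. card (fst ` A)" and ?k = "\<lambda>A :: (nat \<times> nat) set. card (snd ` A)"
  have sum_eq: "(\<Sum>A\<in>P. int (?r A) * int (?k A)) = (int v)\<^sup>2 - int (card P) * (int v - 1)"
    using eq card_Union_blocks_le_sum block_bound(1) by linarith
  note * = block_bound(2)[OF sum_eq]
  then have sum_r: "(\<Sum>A\<in>P. ?r A) = v" and sum_k: "(\<Sum>A\<in>P. ?k A) = v"
    by (simp_all flip: of_nat_sum)
  have "(\<Sum>A\<in>P. int (?r A) * int (?k A) - int (card A)) = 0"
    using sum_eq eq by (simp add: sum_subtractf card_Union_blocks)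
  \<comment> \<open>The differences between rectangle and block are nonnegative and sum to
    0.\<close>
  then have full: "card A = ?r A * ?k A" if "A \<in> P" for A
  proof -
    have "int (?r A) * int (?k A) - int (card A) = 0"
      using that \<open>(\<Sum>A\<in>P. _ A) = 0\<close> card_block_le
      by (subst (asm) sum_nonneg_eq_0_iff[OF finite_P]) auto
    then show ?thesis by (simp flip: of_nat_mult)
  qed
  show ?thesis
  proof (cases "card P = v")
    case True
    \<comment> \<open>There are \<open>v\<close> blocks for \<open>v\<close> rows (or columns), and
      each block takes at least one.\<close>
    have one: "card (f ` A) = 1" if "(\<Sum>A\<in>P. card (f ` A)) = v" "A \<in> P"
      for f :: "nat \<times> nat \<Rightarrow> nat" and A
    proof -
      have "(\<Sum>A\<in>P. int (card (f ` A)) - 1) = 0"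
        using that True by (simp add: sum_subtractf flip: of_nat_sum)
      then have "int (card (f ` A)) - 1 = 0"
        using that(2) one_le_card_image[of f]
        by (subst (asm) sum_nonneg_eq_0_iff[OF finite_P]) force+
      then show ?thesis by simp
    qed
    show ?thesis
      using True one[OF sum_r] one[OF sum_k] card_1_if_card_fst_snd[OF finite_block nonempty]
      by simp
  next
    case False
    with * have "card P = 2" by simp
    then obtain A B where AB: "P = {A, B}" "A \<noteq> B"
      by (auto simp: card_2_iff)
    have v: "2 < v"
      using False \<open>card P = 2\<close> sum_r one_le_card_image[of fst]
      by (simp add: AB)
    have pairs: "?r A = 1 \<or> ?k B = 1" "?r B = 1 \<or> ?k A = 1"
      using * AB by auto
    have sums: "?r A + ?r B = v" "?k A + ?k B = v"
      using sum_r sum_k AB by auto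
    \<comment> \<open>Stated for arbitrary \<open>A\<close> and \<open>B\<close>, since either of
      the two blocks may turn out to be the single cell.\<close>
    have corner: ?thesis
      if AB: "P = {A, B}" "A \<noteq> B" and 1: "?r A = 1" "?k A = 1"
        and sums: "?r A + ?r B = v" "?k A + ?k B = v" for A B
    proof -
      obtain i j where A: "A = {(i, j)}"
        using card_1_if_card_fst_snd[of A] 1 finite_block nonempty AB
        by (auto simp: card_1_singleton_iff)
      let ?C = "({..<v} - {i}) \<times> ({..<v} - {j})"
      have ij: "i < v" "j < v" using in_grid AB A by auto
      have "B \<subseteq> ?C"
      proof
        fix y assume y: "y \<in> B"
        then have "y \<in> {..<v} \<times> {..<v}" using in_grid[of B] AB by auto
        moreover have "i \<notin> fst ` B" "j \<notin> snd ` B"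
          using rows[of A B] cols[of A B] AB A by auto
        then have "fst y \<noteq> i" "snd y \<noteq> j" using y by auto
        ultimately show "y \<in> ?C" by (auto simp: mem_Times_iff)
      qed
      \<comment> \<open>As a full rectangle, \<open>B\<close> has \<open>(v - 1) * (v - 1)\<close>
        cells, as many as \<open>?C\<close>, so the inclusion is an equality.\<close>
      moreover have "?r B = v - 1" "?k B = v - 1" using 1 sums by linarith+
      then have "card B = card ?C"
        using full[of B] AB ij by (simp add: card_cartesian_product)
      ultimately have "B = ?C" by (simp add: card_subset_eq)
      then have U: "\<Union>P = insert (i, j) ?C"
        unfolding AB(1) A by simp
      have "?C = {y \<in> {..<v} \<times> {..<v}. fst y \<noteq> fst (i, j) \<and> snd y \<noteq> snd (i, j)}"
        by auto
      note U' = U[unfolded this]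
      have "(i, j) \<in> \<Union>P" unfolding U by (rule insertI1)
      with U' show ?thesis by (intro disjI2 bexI)
    qed
    \<comment> \<open>The mixed choices in \<open>pairs\<close> give each block a single row, or
      each a single column; then \<open>v = 2\<close>, which \<open>2 < v\<close> excludes.\<close>
    have "?r A = 1 \<and> ?k A = 1 \<or> ?r B = 1 \<and> ?k B = 1"
      using pairs sums v by linarith
    then show ?thesis
    proof
      assume "?r A = 1 \<and> ?k A = 1"
      then show ?thesis by (intro corner[OF AB _ _ sums]) simp_all
    next
      assume B: "?r B = 1 \<and> ?k B = 1"
      have "P = {B, A}" unfolding AB(1) by (rule insert_commute)
      then show ?thesis
        using B sums by (intro corner[OF _ AB(2)[symmetric]]) simp_all
    qed
  qed
qed

end

section \<open>Components after the removal of vertices\<close>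

lemma verts_lattice_graph: "verts (L\<^sub>2 v) = {..<v} \<times> {..<v}"
  by (simp add: lattice_graph_def)

lemma arcs_ends_lattice_graph:
  "p \<rightarrow>\<^bsub>L\<^sub>2 v\<^esub> q \<longleftrightarrow> p \<in> {..<v} \<times> {..<v} \<and> q \<in> {..<v} \<times> {..<v} \<and> p \<noteq> q \<and> (fst p = fst q \<or> snd p = snd q)"
  by (simp add: lattice_graph_def)

text \<open>The subgraph induced on \<open>I\<close> has no arcs, so reachability in it is equality
  and every component is a singleton.\<close>

lemma (in wf_digraph) components_without_compl_independent:
  assumes "independent_set G I"
  shows "components_without G (verts G - I) = card I"
proof -
  have I: "I \<subseteq> verts G" using assms by (simp add: independent_set_def)
  interpret H: wf_digraph "G \<restriction> I" by (rule wellformed_induce_subgraph)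
  have "u = w" if "u \<rightarrow>\<^sup>*\<^bsub>G \<restriction> I\<^esub> w" for u w
    using that
  proof (induction rule: H.reachable_induct)
    case (step x y)
    then have "x \<in> I" "y \<in> I" "x \<rightarrow>\<^bsub>G\<^esub> y"
      using H.adj_in_verts[of x y] dominates_induce_subgraphD by auto
    then show ?case using assms by (simp add: independent_set_def)
  qed simp
  then have "H.scc_of u = {u}" if "u \<in> I" for u
    using that H.in_scc_of_self[of u] by (auto simp: H.scc_of_def)
  then have "H.sccs_verts = (\<lambda>u. {u}) ` I"
    by (simp add: H.sccs_verts_conv_scc_of)
  then have "card H.sccs_verts = card I"
    by (simp add: card_image)
  then show ?thesis
    using I by (simp add: components_without_def double_diff)
qed

text \<open>An arc between two remaining vertices survives in the induced subgraph. Its reverse does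
  too, by symmetry, so its ends are mutually reachable and lie in one strongly connected
  component.\<close>

lemma (in graph) components_partition:
  fixes S
  defines "P \<equiv> pre_digraph.sccs_verts (G \<restriction> (verts G - S))"
  shows "finite P" and "\<Union>P = verts G - S" and "A \<in> P \<Longrightarrow> A \<noteq> {}"
    and "\<lbrakk>A \<in> P; B \<in> P; A \<noteq> B; x \<in> A; y \<in> B\<rbrakk> \<Longrightarrow> x \<noteq> y \<and> \<not> x \<rightarrow>\<^bsub>G\<^esub> y"
proof -
  let ?H = "G \<restriction> (verts G - S)"
  interpret H: digraph ?H
    by (intro digraphI_induced induced_induce) auto
  show "finite P"
    unfolding P_def by (rule H.finite_sccs_verts)
  show U: "\<Union>P = verts G - S"
    unfolding P_def using H.sccs_verts_subsets H.scc_of_in_sccs_verts H.in_scc_of_self by fastforce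
  show "A \<in> P \<Longrightarrow> A \<noteq> {}"
    by (simp add: P_def H.in_sccs_verts_conv_reachable)
  assume AB: "A \<in> P" "B \<in> P" "A \<noteq> B" "x \<in> A" "y \<in> B"
  then have disj: "A \<inter> B = {}"
    using H.sccs_verts_disjoint by (simp add: P_def)
  have "\<not> x \<rightarrow>\<^bsub>G\<^esub> y"
  proof
    assume "x \<rightarrow>\<^bsub>G\<^esub> y"
    moreover have "x \<in> verts G - S" "y \<in> verts G - S" using AB U by auto
    moreover have "y \<rightarrow>\<^bsub>G\<^esub> x" using \<open>x \<rightarrow>\<^bsub>G\<^esub> y\<close> sym_arcs by (rule arcs_ends_symmetric[rotated])
    ultimately have "x \<rightarrow>\<^bsub>?H\<^esub> y" "y \<rightarrow>\<^bsub>?H\<^esub> x"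
      by (auto simp: arcs_ends_conv)
    then have "x \<rightarrow>\<^sup>*\<^bsub>?H\<^esub> y" "y \<rightarrow>\<^sup>*\<^bsub>?H\<^esub> x" by auto
    moreover have "y \<notin> A" using AB disj by auto
    ultimately show False
      using AB by (auto simp: P_def H.in_sccs_verts_conv_reachable)
  qed
  then show "x \<noteq> y \<and> \<not> x \<rightarrow>\<^bsub>G\<^esub> y" using AB disj by auto
qed

text \<open>Distinct cells in a common row or column are adjacent, hence cannot lie in different
  components. Together the claims supply the assumptions of \<open>grid_blocks\<close> except
  \<open>two_le\<close>.\<close>

lemma lattice_graph_components:
  fixes v S
  defines "P \<equiv> pre_digraph.sccs_verts (L\<^sub>2 v \<restriction> (verts (L\<^sub>2 v) - S))"
  shows "finite P" and "\<Union>P = {..<v} \<times> {..<v} - S" and "A \<in> P \<Longrightarrow> A \<noteq> {}"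
    and "A \<in> P \<Longrightarrow> A \<subseteq> {..<v} \<times> {..<v}"
    and "\<lbrakk>A \<in> P; B \<in> P; A \<noteq> B\<rbrakk> \<Longrightarrow> fst ` A \<inter> fst ` B = {}"
    and "\<lbrakk>A \<in> P; B \<in> P; A \<noteq> B\<rbrakk> \<Longrightarrow> snd ` A \<inter> snd ` B = {}"
proof -
  interpret graph "L\<^sub>2 v" by (rule graph_lattice_graph)
  note part = components_partition[where S = S, folded P_def]
  show "finite P" "\<Union>P = {..<v} \<times> {..<v} - S" "A \<in> P \<Longrightarrow> A \<noteq> {}"
    using part(1,2,3) by (simp_all add: verts_lattice_graph)
  then show grid: "A \<subseteq> {..<v} \<times> {..<v}" if "A \<in> P" for A
    using that by blast
  assume AB: "A \<in> P" "B \<in> P" "A \<noteq> B"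
  have "fst x \<noteq> fst y \<and> snd x \<noteq> snd y" if "x \<in> A" "y \<in> B" for x y
    using part(4)[OF AB that] grid[OF AB(1)] grid[OF AB(2)] that
    by (simp add: arcs_ends_lattice_graph) blast
  then show "fst ` A \<inter> fst ` B = {}" "snd ` A \<inter> snd ` B = {}"
    by fastforce+
qed

lemma grid_blocks_lattice_graph:
  assumes "disconnecting (L\<^sub>2 v) S"
  shows "grid_blocks (pre_digraph.sccs_verts (L\<^sub>2 v \<restriction> (verts (L\<^sub>2 v) - S))) v"
  by (rule grid_blocks.intro; (rule lattice_graph_components; assumption)?)
    (use assms in \<open>simp add: disconnecting_def components_without_def\<close>)

section \<open>Independent sets of the lattice graph\<close>

text \<open>Two cells of an independent set never share a row, so \<open>fst\<close> is injective on
  it.\<close>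

lemma card_independent_set_lattice_graph:
  assumes "independent_set (L\<^sub>2 v) J"
  shows "card J \<le> v"
proof -
  have J: "J \<subseteq> {..<v} \<times> {..<v}" "\<And>x y. x \<in> J \<Longrightarrow> y \<in> J \<Longrightarrow> \<not> x \<rightarrow>\<^bsub>L\<^sub>2 v\<^esub> y"
    using assms by (auto simp: independent_set_def verts_lattice_graph)
  have "inj_on fst J"
  proof (rule inj_onI)
    fix x y assume "x \<in> J" "y \<in> J" "fst x = fst y"
    then show "x = y"
      using J(1) J(2)[of x y] unfolding arcs_ends_lattice_graph by blast
  qed
  then have "card J \<le> card {..<v}"
    using J by (intro card_inj_on_le[of fst]) auto
  then show ?thesis by simp
qed

lemma independent_set_diagonal: "independent_set (L\<^sub>2 v) ((\<lambda>i. (i, i)) ` {..<v})"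
  by (auto simp: independent_set_def verts_lattice_graph arcs_ends_lattice_graph)

section \<open>The toughness bound and its equality cases\<close>

lemma card_compl_grid:
  assumes "S \<subseteq> {..<v} \<times> {..<v}"
  shows "int (card ({..<v} \<times> {..<v} - S)) = (int v)\<^sup>2 - int (card S)"
proof -
  have "card S \<le> card ({..<v} \<times> {..<v})" using assms by (intro card_mono) auto
  then show ?thesis
    using assms
    by (simp add: card_Diff_subset finite_subset of_nat_diff power2_eq_square card_cartesian_product)
qed

text \<open>The components cover exactly the cells outside \<open>S\<close>, so the upper bound on
  \<open>card (\<Union>P)\<close> becomes a lower bound on \<open>card S\<close>.\<close>

lemma disconnecting_lattice_graph_bound:
  assumes "disconnecting (L\<^sub>2 v) S"
  shows "int (components_without (L\<^sub>2 v) S) * (int v - 1) \<le> int (card S)"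
proof -
  interpret grid_blocks "pre_digraph.sccs_verts (L\<^sub>2 v \<restriction> (verts (L\<^sub>2 v) - S))" v
    using assms by (rule grid_blocks_lattice_graph)
  have "S \<subseteq> {..<v} \<times> {..<v}"
    using assms by (simp add: disconnecting_def verts_lattice_graph)
  then show ?thesis
    using card_Union_blocks_le card_compl_grid unfolding lattice_graph_components(2)
    by (simp add: components_without_def)
qed

text \<open>Equality passes to the blocks, and the two alternatives of
  \<open>card_Union_blocks_eq\<close> become the two kinds of extremal sets on taking
  complements.\<close>

lemma disconnecting_lattice_graph_eq:
  assumes S: "disconnecting (L\<^sub>2 v) S"
    and eq: "int (card S) = int (components_without (L\<^sub>2 v) S) * (int v - 1)"
  shows "(\<exists>I. maximum_independent_set (L\<^sub>2 v) I \<and> card I = v \<and> S = verts (L\<^sub>2 v) - I) \<or>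
    (\<exists>x\<in>verts (L\<^sub>2 v). S = neighborhood (L\<^sub>2 v) x)"
proof -
  define P where "P = pre_digraph.sccs_verts (L\<^sub>2 v \<restriction> (verts (L\<^sub>2 v) - S))"
  note part = lattice_graph_components[where v = v and S = S, folded P_def]
  interpret grid_blocks P v
    unfolding P_def using S by (rule grid_blocks_lattice_graph)
  have sub: "S \<subseteq> {..<v} \<times> {..<v}"
    using S by (simp add: disconnecting_def verts_lattice_graph)
  have card_U: "int (card (\<Union>P)) = (int v)\<^sup>2 - int (card P) * (int v - 1)"
    using eq card_compl_grid[OF sub] unfolding part(2) by (simp add: components_without_def P_def)
  have S_eq: "S = {..<v} \<times> {..<v} - \<Union>P"
    using sub part(2) by auto
  from card_Union_blocks_eq[OF card_U] show ?thesis
  proof (elim disjE conjE bexE)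
    assume P: "card P = v" "\<forall>A\<in>P. card A = 1"
    have "independent_set (L\<^sub>2 v) (\<Union>P)"
      unfolding independent_set_def
    proof (intro conjI ballI)
      show "\<Union>P \<subseteq> verts (L\<^sub>2 v)" by (simp add: part(2) verts_lattice_graph)
      fix x y assume "x \<in> \<Union>P" "y \<in> \<Union>P"
      then obtain A B where AB: "A \<in> P" "B \<in> P" "x \<in> A" "y \<in> B" by auto
      show "\<not> x \<rightarrow>\<^bsub>L\<^sub>2 v\<^esub> y"
      proof (cases "A = B")
        case True
        then have "x = y" using P(2) AB by (metis card_1_singletonE singletonD)
        then show ?thesis by (simp add: arcs_ends_lattice_graph)
      next
        case False
        then show ?thesis
          using part(5,6)[OF AB(1,2)] AB by (auto simp: arcs_ends_lattice_graph)
      qed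
    qed
    \<comment> \<open>For \<open>card P = v\<close>, the count in \<open>card_U\<close> is
      \<open>v\<^sup>2 - v * (v - 1) = v\<close>. This meets the upper bound for independent sets,
      whence maximality.\<close>
    moreover have "card (\<Union>P) = v"
      using card_U P(1) by (simp add: power2_eq_square algebra_simps)
    ultimately have "maximum_independent_set (L\<^sub>2 v) (\<Union>P) \<and> card (\<Union>P) = v"
      using card_independent_set_lattice_graph by (auto simp: maximum_independent_set_def)
    then show ?thesis using S_eq by (auto simp: verts_lattice_graph)
  next
    fix x assume x: "x \<in> \<Union>P"
      and U: "\<Union>P = insert x {y \<in> {..<v} \<times> {..<v}. fst y \<noteq> fst x \<and> snd y \<noteq> snd x}"
    have grid: "x \<in> {..<v} \<times> {..<v}" using x part(2) by auto
    \<comment> \<open>Outside \<open>x\<close> and the cells off its row and column there remain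
      exactly the other cells of that row and column.\<close>
    have "S = neighborhood (L\<^sub>2 v) x"
      using grid unfolding S_eq U neighborhood_def arcs_ends_lattice_graph by auto
    then show ?thesis using grid by (auto simp: verts_lattice_graph)
  qed
qed

theorem theorem4p1:
  fixes v :: nat
  assumes "v \<ge> 2"
  shows "toughness (L\<^sub>2 v) = real v - 1 \<and>
    (\<forall>S. disconnecting (L\<^sub>2 v) S \<longrightarrow>
         real (card S) / real (components_without (L\<^sub>2 v) S) = real v - 1 \<longrightarrow>
         (\<exists>I. maximum_independent_set (L\<^sub>2 v) I \<and> card I = v \<and> S = verts (L\<^sub>2 v) - I) \<or>
         (\<exists>x\<in>verts (L\<^sub>2 v). S = neighborhood (L\<^sub>2 v) x))"
proof (intro conjI allI impI)
  interpret graph "L\<^sub>2 v" by (rule graph_lattice_graph)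
  \<comment> \<open>The complement of the diagonal attains the minimum: it has
    \<open>v\<^sup>2 - v\<close> cells and leaves \<open>v\<close> isolated ones. Since
    \<open>v \<ge> 2\<close>, it is disconnecting.\<close>
  define I where "I = (\<lambda>i. (i, i)) ` {..<v}"
  have I_sub: "I \<subseteq> {..<v} \<times> {..<v}" by (auto simp: I_def)
  have card_I: "card I = v" by (simp add: I_def card_image inj_on_def)
  have comp: "components_without (L\<^sub>2 v) (verts (L\<^sub>2 v) - I) = v"
    using components_without_compl_independent[OF independent_set_diagonal] card_I
    by (simp add: I_def)
  have "real_of_int (int (card (verts (L\<^sub>2 v) - I))) = (real v)\<^sup>2 - real v"
    using card_compl_grid[of I v] card_I I_sub by (simp add: verts_lattice_graph)
  then have ratio: "real (card (verts (L\<^sub>2 v) - I)) /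
      real (components_without (L\<^sub>2 v) (verts (L\<^sub>2 v) - I)) = real v - 1"
    using assms by (simp add: comp field_simps power2_eq_square)
  show "toughness (L\<^sub>2 v) = real v - 1"
    unfolding toughness_def
  proof (rule Min_eqI)
    \<comment> \<open>\<open>Min\<close> is determined only for finite sets; the disconnecting sets
      are among the finitely many sets of vertices.\<close>
    have "{S. disconnecting (L\<^sub>2 v) S} \<subseteq> Pow (verts (L\<^sub>2 v))"
      by (auto simp: disconnecting_def)
    then show "finite ((\<lambda>S. real (card S) / real (components_without (L\<^sub>2 v) S)) `
        {S. disconnecting (L\<^sub>2 v) S})"
      by (meson finite_Pow_iff finite_imageI finite_subset finite_verts)
    have "disconnecting (L\<^sub>2 v) (verts (L\<^sub>2 v) - I)"
      using assms comp by (simp add: disconnecting_def)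
    then show "real v - 1 \<in> (\<lambda>S. real (card S) / real (components_without (L\<^sub>2 v) S)) `
        {S. disconnecting (L\<^sub>2 v) S}"
      unfolding ratio[symmetric] by (intro imageI CollectI)
    fix q assume "q \<in> (\<lambda>S. real (card S) / real (components_without (L\<^sub>2 v) S)) `
        {S. disconnecting (L\<^sub>2 v) S}"
    then obtain S where S: "disconnecting (L\<^sub>2 v) S"
      and q: "q = real (card S) / real (components_without (L\<^sub>2 v) S)" by auto
    have "0 < real (components_without (L\<^sub>2 v) S)"
      using S by (simp add: disconnecting_def)
    moreover have "real (components_without (L\<^sub>2 v) S) * (real v - 1) \<le> real (card S)"
      using of_int_le_iff[where 'a = real, THEN iffD2, OF disconnecting_lattice_graph_bound[OF S]]
      by simp
    ultimately show "real v - 1 \<le> q"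
      by (simp add: q pos_le_divide_eq mult.commute)
  qed
next
  fix S assume S: "disconnecting (L\<^sub>2 v) S"
    and q: "real (card S) / real (components_without (L\<^sub>2 v) S) = real v - 1"
  have "components_without (L\<^sub>2 v) S \<noteq> 0"
    using S by (simp add: disconnecting_def)
  then have "real (card S) = real (components_without (L\<^sub>2 v) S) * (real v - 1)"
    using q by (simp add: field_simps)
  then have "real_of_int (int (card S)) =
      real_of_int (int (components_without (L\<^sub>2 v) S) * (int v - 1))"
    by simp
  then have "int (card S) = int (components_without (L\<^sub>2 v) S) * (int v - 1)"
    unfolding of_int_eq_iff .
  then show "(\<exists>I. maximum_independent_set (L\<^sub>2 v) I \<and> card I = v \<and> S = verts (L\<^sub>2 v) - I) \<or>
      (\<exists>x\<in>verts (L\<^sub>2 v). S = neighborhood (L\<^sub>2 v) x)"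
    by (rule disconnecting_lattice_graph_eq[OF S])
qed

end
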